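(* Let $(m^n_t)_{t\in[0,T]}$ be a given mean-field trajectory. Consider the drift $f=A(t)x+Bu$ with $B$ a constant matrix, diffusion coefficient $\sigma=\sigma(t)$, instantaneous cost $c=x'\big(Q(t)-\Lambda(t,m^n_t)\big)x+\|u\|^2$, where $\Lambda$ is symmetric and continuous in $(t,m)$, and terminal cost $g(x)=x'Q_Tx$, where $Q(t)\ge0$ is symmetric and continuous and $Q_T\ge0$. Then the generalized Riccati equation becomes $$\dot Z^*+A'Z^*+Z^*A+Q-\Lambda(t,m^n_t)-Z^*\Big(BB'-\frac1{\rho^2}\sigma\sigma'\Big)Z^*=0,\qquad Z^*(T)=Q_T,$$ with $\rho=(\delta/(2\epsilon))^{1/2}$; that is, whenever a nonnegative definite solution $Z^*$ of this equation exists on $[0,T]$, the solution of the risk-sensitive Hamilton-Jacobi-Bellman equation $$\partial_tv^n+\inf_{u}\Big\{f\cdot\partial_xv^n+\frac\epsilon2\mathrm{tr}(\sigma\sigma'\partial^2_{xx}v^n)+\frac{\epsilon}{2\delta}\|\sigma'\partial_xv^n\|^2+c\Big\}=0,\qquad v^n(T,x)=g(x),$$ is given by $$v^n(t,x)=x'Z^*(t)x+\epsilon\int_t^T\mathrm{tr}\big(Z^*(s)\sigma(s)\sigma(s)'\big)\,ds .$$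
   Context: A prime denotes transpose; gradients are column vectors; $T,\epsilon,\delta>0$ are fixed. The state of a generic player, $x\in\mathbb{R}^k$, follows $dx(t)=(A(t)x(t)+Bu(t))\,dt+\sqrt\epsilon\,\sigma(t)\,d\mathbb{B}(t)$ with $\mathbb{B}$ a standard Brownian motion in $\mathbb{R}^k$ and control $u(t)\in\mathbb{R}^p$. The process $m^n_t$ is the empirical measure of the states of the $n$ players, considered as a given exogenous trajectory. The player minimizes the risk-sensitive cost $\delta\log\mathbb{E}\big(e^{\frac1\delta[g(x(T))+\int_t^Tc(s,x(s),u(s),m^n_s)ds]}\,\big|\,x(t)=x\big)$ and $v^n(t,x)$ denotes the corresponding value function, characterized by the Hamilton-Jacobi-Bellman equation in the claim, with the infimum over $u\in\mathbb{R}^p$.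
   Formalization: A(t) and σ(t) are additionally assumed continuous on [0,T], so that the equation holds classically, and "the solution" means the unique classical solution whose gradient in x grows at most linearly, since uniqueness fails without a growth condition. *)

theory Defs
  imports "HOL-Analysis.Analysis"
begin

definition nonneg_definite :: "real^'k^'k \<Rightarrow> bool" where
  "nonneg_definite M \<longleftrightarrow> transpose M = M \<and> (\<forall>x. 0 \<le> x \<bullet> (M *v x))"

(* (1/n) * (sum over j < n of the Dirac mass at xi j), as a measure on the Borel sets *)
definition empirical_measure ::
    "nat \<Rightarrow> (nat \<Rightarrow> 'a::topological_space) \<Rightarrow> 'a measure" where
  "empirical_measure n \<xi> = distr (uniform_count_measure {..<n}) borel \<xi>"

definition weakly_converges ::
    "(nat \<Rightarrow> 'a::topological_space measure) \<Rightarrow> 'a measure \<Rightarrow> bool" where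
  "weakly_converges \<mu> \<nu> \<longleftrightarrow>
     (\<forall>\<phi>::'a \<Rightarrow> real. continuous_on UNIV \<phi> \<and> bounded (range \<phi>) \<longrightarrow>
        (\<lambda>i. \<integral>x. \<phi> x \<partial>\<mu> i) \<longlonglongrightarrow> (\<integral>x. \<phi> x \<partial>\<nu>))"

(* Joint continuity of F on [0,T] x {n-point empirical measures on R^k}. This domain is metrizable,
   so sequences suffice; on it the weak topology agrees with all Wasserstein topologies, since
   every atom has mass at least 1/n. In particular F may depend on moments of the measure. *)
definition continuous_on_empirical ::
    "nat \<Rightarrow> real \<Rightarrow> (real \<Rightarrow> (real^'k) measure \<Rightarrow> 'b::topological_space) \<Rightarrow> bool" where
  "continuous_on_empirical n T F \<longleftrightarrow>
     (\<forall>s t \<mu> \<nu>.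
        (\<forall>i. s i \<in> {0..T} \<and> \<mu> i \<in> range (empirical_measure n)) \<and>
        t \<in> {0..T} \<and> \<nu> \<in> range (empirical_measure n) \<and>
        s \<longlonglongrightarrow> t \<and> weakly_converges \<mu> \<nu> \<longrightarrow>
        (\<lambda>i. F (s i) (\<mu> i)) \<longlonglongrightarrow> F t \<nu>)"

(* The expression under the infimum, for control value u, time t, state x, measure mu;
   p stands for the gradient and X for the Hessian of the value function at (t,x). *)
definition rs_hamiltonian ::
    "real \<Rightarrow> real \<Rightarrow> (real \<Rightarrow> real^'k \<Rightarrow> real^'p \<Rightarrow> real^'k) \<Rightarrow> (real \<Rightarrow> real^'k^'k) \<Rightarrow>
     (real \<Rightarrow> real^'k \<Rightarrow> real^'p \<Rightarrow> (real^'k) measure \<Rightarrow> real) \<Rightarrow>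
     real \<Rightarrow> real^'k \<Rightarrow> (real^'k) measure \<Rightarrow> real^'k \<Rightarrow> real^'k^'k \<Rightarrow> real^'p \<Rightarrow> real" where
  "rs_hamiltonian \<epsilon> \<delta> f \<sigma> c t x \<mu> p X u =
     f t x u \<bullet> p + \<epsilon> / 2 * trace (\<sigma> t ** transpose (\<sigma> t) ** X)
     + \<epsilon> / (2 * \<delta>) * (norm (transpose (\<sigma> t) *v p))\<^sup>2 + c t x u \<mu>"

(* Classical C^{1,2} solution on [0,T] x R^k (one-sided time derivatives at 0 and T).
   The bdd_below clause makes INF the true infimum rather than an unspecified real. *)
definition rs_hjb_solution ::
    "real \<Rightarrow> real \<Rightarrow> real \<Rightarrow> (real \<Rightarrow> real^'k \<Rightarrow> real^'p \<Rightarrow> real^'k) \<Rightarrow> (real \<Rightarrow> real^'k^'k) \<Rightarrow>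
     (real \<Rightarrow> real^'k \<Rightarrow> real^'p \<Rightarrow> (real^'k) measure \<Rightarrow> real) \<Rightarrow> (real^'k \<Rightarrow> real) \<Rightarrow>
     (real \<Rightarrow> (real^'k) measure) \<Rightarrow> (real \<Rightarrow> real^'k \<Rightarrow> real) \<Rightarrow> bool" where
  "rs_hjb_solution T \<epsilon> \<delta> f \<sigma> c g m v \<longleftrightarrow>
     (\<forall>x. v T x = g x) \<and>
     (\<exists>vt vx vxx.
        continuous_on ({0..T} \<times> UNIV) (\<lambda>(t, x). vt t x) \<and>
        continuous_on ({0..T} \<times> UNIV) (\<lambda>(t, x). vx t x) \<and>
        continuous_on ({0..T} \<times> UNIV) (\<lambda>(t, x). vxx t x) \<and>
        (\<forall>t\<in>{0..T}. \<forall>x.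
           ((\<lambda>s. v s x) has_real_derivative vt t x) (at t within {0..T}) \<and>
           GDERIV (v t) x :> vx t x \<and>
           (vx t has_derivative (\<lambda>h. vxx t x *v h)) (at x) \<and>
           bdd_below (range (rs_hamiltonian \<epsilon> \<delta> f \<sigma> c t x (m t) (vx t x) (vxx t x))) \<and>
           vt t x + (INF u. rs_hamiltonian \<epsilon> \<delta> f \<sigma> c t x (m t) (vx t x) (vxx t x) u) = 0))"

(* Growth class in which "the" solution of the HJB equation is meant. Without a growth condition
   classical solutions are not unique: if B B' = sigma sigma' / rho^2 the equation is a linear
   heat-type equation, which has Tychonoff null solutions. *)
definition linear_gradient_growth :: "real \<Rightarrow> (real \<Rightarrow> real^'k \<Rightarrow> real) \<Rightarrow> bool" where
  "linear_gradient_growth T v \<longleftrightarrow>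
     (\<exists>C. \<forall>t\<in>{0..T}. \<forall>x p. GDERIV (v t) x :> p \<longrightarrow> norm p \<le> C * (1 + norm x))"

(* R t is the symmetric weight of the quadratic running cost x' R(t) x. *)
definition riccati_solution ::
    "real \<Rightarrow> real \<Rightarrow> (real \<Rightarrow> real^'k^'k) \<Rightarrow> real^'p^'k \<Rightarrow> (real \<Rightarrow> real^'k^'k) \<Rightarrow>
     (real \<Rightarrow> real^'k^'k) \<Rightarrow> real^'k^'k \<Rightarrow> (real \<Rightarrow> real^'k^'k) \<Rightarrow> bool" where
  "riccati_solution T \<rho> A B \<sigma> R Q\<^sub>T Z \<longleftrightarrow>
     Z T = Q\<^sub>T \<and>
     (\<exists>Zdot. \<forall>t\<in>{0..T}.
        (Z has_vector_derivative Zdot t) (at t within {0..T}) \<and>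
        Zdot t + transpose (A t) ** Z t + Z t ** A t + R t
          - Z t ** (B ** transpose B - (1 / \<rho>\<^sup>2) *\<^sub>R (\<sigma> t ** transpose (\<sigma> t))) ** Z t = 0)"

end

theory Submission
  imports Defs
begin

text \<open>
  For fixed state and gradient \<open>p\<close> the expression under the infimum is a quadratic polynomial in the
  control, and completing the square (\<open>INF_rs_hamiltonian\<close>) evaluates the infimum. What remains is
  \<open>A x \<bullet> p - (p \<bullet> G p) / 4\<close> plus terms free of \<open>p\<close>, with \<open>G = B B' - \<sigma> \<sigma>' / \<rho>\<^sup>2\<close>, the matrix of
  the Riccati equation. Inserting a quadratic function \<open>x \<bullet> Z x\<close> plus a function of time makes the
  equation split into a quadratic part, which is the Riccati equation, and a part constant in \<open>x\<close>,
  which fixes the integral term (\<open>riccati_imp_rs_hjb_solution\<close>). The mean field enters only as a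
  time-dependent coefficient; weak continuity of the empirical measures makes it continuous
  (\<open>continuous_on_empirical_along_trajectory\<close>), so that \<open>v\<close> is a classical solution.

  Uniqueness is a matter of partial differential equations rather than of control. The difference
  of two solutions solves a linear backward parabolic equation with zero terminal value, because a
  difference of quadratic forms factorises (\<open>rs_hjb_comparison\<close>). If both gradients grow at most
  linearly, so do the coefficients of this equation, while the difference itself grows at most
  quadratically (\<open>gradient_growth_imp_quadratic_growth\<close>). A maximum principle on the whole space,
  obtained from a barrier of quartic growth (\<open>parabolic_maximum_principle\<close>), then shows that the
  difference is nonpositive, and exchanging the two solutions shows that it vanishes.
\<close>

section \<open>A maximum principle for linear parabolic equations on the whole space\<close>

lemma square_one_plus_le:
  fixes a :: real
  assumes "0 \<le> a"
  shows "(1 + a)\<^sup>2 \<le> 2 * (1 + a\<^sup>2)" and "(1 + a) * a \<le> 2 * (1 + a\<^sup>2)"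
proof -
  show *: "(1 + a)\<^sup>2 \<le> 2 * (1 + a\<^sup>2)"
    using zero_le_power2[of "a - 1"] by (simp add: power2_eq_square algebra_simps)
  have "(1 + a) * a \<le> (1 + a)\<^sup>2" using assms by (simp add: power2_eq_square algebra_simps)
  with * show "(1 + a) * a \<le> 2 * (1 + a\<^sup>2)" by linarith
qed

text \<open>Restricting \<open>f\<close> to lines through \<open>x\<close> reduces the claim to one variable: if
  \<open>s \<bullet> H s\<close> were positive, the derivative along \<open>s\<close>, which vanishes at \<open>x\<close>, would be positive
  just after it, and \<open>f\<close> would exceed its maximum there.\<close>

lemma second_order_condition_at_maximum:
  fixes f :: "'a::real_inner \<Rightarrow> real" and G :: "'a \<Rightarrow> 'a"
  assumes grad: "\<And>x. GDERIV f x :> G x"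
    and hess: "(G has_derivative H) (at x)"
    and "0 < r" and max: "\<And>y. y \<in> ball x r \<Longrightarrow> f y \<le> f x"
  shows "G x = 0" and "s \<bullet> H s \<le> 0"
proof -
  have "(\<lambda>h. h \<bullet> G x) = (\<lambda>h. 0)"
    using grad[of x] max \<open>0 < r\<close> unfolding gderiv_def
    by (intro differential_zero_maxmin[of x "ball x r" f]) auto
  then have "G x \<bullet> G x = 0" by metis
  then show "G x = 0" by simp
  show "s \<bullet> H s \<le> 0"
  proof (rule ccontr)
    assume "\<not> s \<bullet> H s \<le> 0"
    then have pos: "0 < s \<bullet> H s" by simp
    have "s \<noteq> 0" using pos by auto
    define \<phi> where "\<phi> = (\<lambda>h. f (x + h *\<^sub>R s))"
    define \<phi>' where "\<phi>' = (\<lambda>h. s \<bullet> G (x + h *\<^sub>R s))"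
    have d1: "(\<phi> has_real_derivative \<phi>' h) (at h)" for h
    proof -
      have "((\<lambda>h. x + h *\<^sub>R s) has_derivative (\<lambda>k. k *\<^sub>R s)) (at h)"
        by (auto intro!: derivative_eq_intros)
      from has_derivative_compose[OF this grad[of "x + h *\<^sub>R s", unfolded gderiv_def]]
      show ?thesis
        unfolding \<phi>_def \<phi>'_def has_field_derivative_def
        by (simp add: mult.commute[of _ "s \<bullet> G (x + h *\<^sub>R s)"])
    qed
    have d2: "(\<phi>' has_real_derivative s \<bullet> H s) (at 0)"
    proof -
      have "((\<lambda>h. x + h *\<^sub>R s) has_derivative (\<lambda>k. k *\<^sub>R s)) (at 0)"
        by (auto intro!: derivative_eq_intros)
      moreover have "(G has_derivative H) (at (x + 0 *\<^sub>R s))"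
        using hess by simp
      ultimately have "((\<lambda>h. G (x + h *\<^sub>R s)) has_derivative (\<lambda>k. H (k *\<^sub>R s))) (at 0)"
        by (rule has_derivative_compose)
      then have "(\<phi>' has_derivative (\<lambda>k. s \<bullet> H (k *\<^sub>R s))) (at 0)"
        unfolding \<phi>'_def by (rule has_derivative_inner_right)
      moreover have "(\<lambda>k. s \<bullet> H (k *\<^sub>R s)) = (\<lambda>k. k * (s \<bullet> H s))"
        using has_derivative_linear[OF hess] by (simp add: linear_cmul)
      ultimately show ?thesis
        unfolding has_field_derivative_def by (simp add: mult.commute[of _ "s \<bullet> H s"])
    qed
    have zero: "\<phi>' 0 = 0" unfolding \<phi>'_def using \<open>G x = 0\<close> by simp
    from DERIV_pos_inc_right[OF d2 pos] obtain d where d: "d > 0" "\<And>h. 0 < h \<Longrightarrow> h < d \<Longrightarrow> 0 < \<phi>' h"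
      using zero by auto
    define e where "e = min (d / 2) (r / (2 * norm s))"
    have e: "0 < e" "e < d" using d \<open>0 < r\<close> \<open>s \<noteq> 0\<close> by (auto simp: e_def min_def)
    have "e * norm s \<le> r / (2 * norm s) * norm s"
      by (intro mult_right_mono) (auto simp: e_def)
    then have "e * norm s < r" using \<open>s \<noteq> 0\<close> \<open>0 < r\<close> by simp
    then have "\<phi> e \<le> \<phi> 0"
      unfolding \<phi>_def using max[of "x + e *\<^sub>R s"] e by (simp add: dist_norm)
    moreover obtain z where "0 < z" "z < e" "\<phi> e - \<phi> 0 = (e - 0) * \<phi>' z"
      using MVT2[OF e(1), of \<phi> \<phi>'] d1 by blast
    ultimately show False using d(2)[of z] e by (smt (verit) mult_pos_pos)
  qed
qed

text \<open>A linear bound on the gradient makes \<open>D t\<close> Lipschitz on each ball uniformly in \<open>t\<close>.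
  Together with continuity in \<open>t\<close> at fixed \<open>x\<close> this gives joint continuity, and comparing
  with the value at the origin gives quadratic growth. These are exactly the two regularity properties
  that the maximum principle below asks for.\<close>

lemma gradient_growth_imp_quadratic_growth:
  fixes D :: "real \<Rightarrow> 'a::real_inner \<Rightarrow> real"
  assumes grad: "\<And>t x. t \<in> {0..T} \<Longrightarrow> GDERIV (D t) x :> Dx t x"
    and bound: "\<And>t x. t \<in> {0..T} \<Longrightarrow> norm (Dx t x) \<le> C * (1 + norm x)"
    and cont: "\<And>x. continuous_on {0..T} (\<lambda>t. D t x)"
  shows "continuous_on ({0..T} \<times> UNIV) (\<lambda>(t, x). D t x)"
    and "\<exists>M. \<forall>t\<in>{0..T}. \<forall>x. D t x \<le> M * (1 + (norm x)\<^sup>2)"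
proof -
  define K where "K = \<bar>C\<bar>"
  have K: "K \<ge> 0" "norm (Dx t x) \<le> K * (1 + norm x)" if "t \<in> {0..T}" for t x
    using bound[OF that, of x] mult_right_mono[of C K "1 + norm x"] abs_ge_self[of C]
    by (auto simp: K_def)
  have lip: "\<bar>D t x - D t y\<bar> \<le> K * (1 + r) * norm (x - y)"
    if "t \<in> {0..T}" "norm x \<le> r" "norm y \<le> r" for t x y r
  proof -
    have "norm (D t x - D t y) \<le> K * (1 + r) * norm (x - y)"
    proof (rule differentiable_bound[of "cball 0 r"])
      show "(D t has_derivative (\<lambda>h. h \<bullet> Dx t z)) (at z within cball 0 r)" for z
        using grad[OF that(1), of z] has_derivative_at_withinI by (auto simp: gderiv_def)
      fix z :: 'a assume "z \<in> cball 0 r"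
      then have "norm z \<le> r" by simp
      have "norm (Dx t z) \<le> K * (1 + r)"
        using K(2)[OF that(1), of z] mult_left_mono[of "1 + norm z" "1 + r" K] \<open>norm z \<le> r\<close>
          K(1)[OF that(1)] by linarith
      then have "norm (h \<bullet> Dx t z) \<le> K * (1 + r) * norm h" for h
        using Cauchy_Schwarz_ineq2[of h "Dx t z"] mult_left_mono[of "norm (Dx t z)" _ "norm h"]
        by (smt (verit) mult.commute norm_ge_zero real_norm_def)
      then show "onorm (\<lambda>h. h \<bullet> Dx t z) \<le> K * (1 + r)"
        using K(1)[OF that(1)] order_trans[OF norm_ge_zero \<open>norm z \<le> r\<close>]
        by (intro onorm_bound) auto
    qed (use that in auto)
    then show ?thesis by simp
  qed
  show "continuous_on ({0..T} \<times> UNIV) (\<lambda>(t, x). D t x)"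
    unfolding continuous_on_def
  proof (clarify)
    fix t and x :: 'a assume t: "t \<in> {0..T}"
    let ?F = "at (t, x) within {0..T} \<times> UNIV"
    have l1: "(fst \<longlongrightarrow> t) ?F" "(snd \<longlongrightarrow> x) ?F"
      using tendsto_fst[OF tendsto_ident_at[of "(t,x)" "{0..T} \<times> UNIV"]]
        tendsto_snd[OF tendsto_ident_at[of "(t,x)" "{0..T} \<times> UNIV"]] by simp_all
    have inT: "\<forall>\<^sub>F z in ?F. fst z \<in> {0..T}"
      unfolding eventually_at_filter by (intro always_eventually) auto
    have a: "((\<lambda>z. D (fst z) x) \<longlongrightarrow> D t x) ?F"
      by (rule continuous_on_tendsto_compose[OF cont l1(1) t inT])
    have near: "\<forall>\<^sub>F z in ?F. norm (snd z) < norm x + 1"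
      using order_tendstoD(2)[OF tendsto_norm[OF l1(2)]] by simp
    have b: "((\<lambda>z. D (fst z) (snd z) - D (fst z) x) \<longlongrightarrow> 0) ?F"
    proof (rule Lim_null_comparison)
      show "\<forall>\<^sub>F z in ?F. norm (D (fst z) (snd z) - D (fst z) x)
              \<le> K * (1 + (norm x + 1)) * norm (snd z - x)"
        using inT near by eventually_elim (simp only: real_norm_def, rule lip, auto)
      show "((\<lambda>z. K * (1 + (norm x + 1)) * norm (snd z - x)) \<longlongrightarrow> 0) ?F"
        using l1(2) by (intro tendsto_mult_right_zero tendsto_norm_zero) (simp add: LIM_zero)
    qed
    show "((\<lambda>(t, x). D t x) \<longlongrightarrow> D t x) ?F"
      using tendsto_add[OF b a] by (simp add: case_prod_unfold)
  qed
  obtain M0 where "\<forall>t\<in>{0..T}. \<bar>D t 0\<bar> \<le> M0"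
    using compact_imp_bounded[OF compact_continuous_image[OF cont[of 0] compact_Icc]]
    by (auto simp: bounded_iff)
  then have M0: "\<And>t. t \<in> {0..T} \<Longrightarrow> \<bar>D t 0\<bar> \<le> M0" by blast
  show "\<exists>M. \<forall>t\<in>{0..T}. \<forall>x. D t x \<le> M * (1 + (norm x)\<^sup>2)"
  proof (intro exI ballI allI)
    fix t and x :: 'a assume t: "t \<in> {0..T}"
    have "D t x \<le> M0 + K * (1 + norm x) * norm x"
      using lip[OF t order_refl, of 0 x] M0[OF t] by simp
    also have "(1 + norm x) * norm x \<le> 2 * (1 + (norm x)\<^sup>2)"
      by (rule square_one_plus_le) simp
    then have "K * (1 + norm x) * norm x \<le> 2 * K * (1 + (norm x)\<^sup>2)"
      using mult_left_mono[of _ _ K] K(1)[OF t] by (fastforce simp: mult.assoc mult.left_commute)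
    moreover have "M0 \<le> M0 * (1 + (norm x)\<^sup>2)"
      using M0[OF t] by (simp add: algebra_simps)
    ultimately show "D t x \<le> (M0 + 2 * K) * (1 + (norm x)\<^sup>2)"
      by (simp add: algebra_simps)
  qed
qed

text \<open>The second-order part is a sum of squares \<open>\<Sum>\<^sub>j s\<^sub>j \<bullet> D\<^sup>2 s\<^sub>j\<close>, so that degenerate ellipticity is
  built in and only second derivatives along the fields \<open>s\<^sub>j\<close> have to be compared. On the unbounded
  domain a maximum need not exist; the proof therefore subtracts a multiple of the barrier
  \<open>\<psi>(t, x) = exp (L (T - t)) (1 + |x|\<^sup>2)\<^sup>2\<close>. Its quartic growth beats the quadratic growth of \<open>D\<close>
  and forces a maximum to be attained, and for \<open>L\<close> large it is a strict supersolution, because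
  coefficients of linear growth map \<open>\<psi>\<close> to at most a constant times \<open>\<psi>\<close>. At a positive maximum of
  \<open>D - \<eta> \<psi>\<close> the first- and second-order conditions contradict the differential inequality;
  then \<open>\<eta>\<close> tends to \<open>0\<close>.\<close>

lemma parabolic_maximum_principle:
  fixes D :: "real \<Rightarrow> 'a::euclidean_space \<Rightarrow> real"
    and Dx b :: "real \<Rightarrow> 'a \<Rightarrow> 'a" and s :: "'j \<Rightarrow> real \<Rightarrow> 'a \<Rightarrow> 'a"
  assumes cont: "continuous_on ({0..T} \<times> UNIV) (\<lambda>(t, x). D t x)"
    and growth: "\<And>t x. t \<in> {0..T} \<Longrightarrow> D t x \<le> M * (1 + (norm x)\<^sup>2)"
    and dt: "\<And>t x. t \<in> {0..T} \<Longrightarrow> ((\<lambda>s. D s x) has_real_derivative Dt t x) (at t within {0..T})"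
    and dx: "\<And>t x. t \<in> {0..T} \<Longrightarrow> GDERIV (D t) x :> Dx t x"
    and dxx: "\<And>t x. t \<in> {0..T} \<Longrightarrow> (Dx t has_derivative Dxx t x) (at x)"
    and subsol: "\<And>t x. t \<in> {0..T} \<Longrightarrow>
        0 \<le> Dt t x + b t x \<bullet> Dx t x + (\<Sum>j\<in>J. s j t x \<bullet> Dxx t x (s j t x))"
    and "0 \<le> K"
    and b: "\<And>t x. t \<in> {0..T} \<Longrightarrow> norm (b t x) \<le> K * (1 + norm x)"
    and s: "\<And>j t x. j \<in> J \<Longrightarrow> t \<in> {0..T} \<Longrightarrow> norm (s j t x) \<le> K * (1 + norm x)"
    and final: "\<And>x. D T x \<le> 0"
    and t1: "t1 \<in> {0..T}"
  shows "D t1 x1 \<le> 0"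
proof -
  define N :: "'a \<Rightarrow> real" where "N = (\<lambda>x. 1 + (norm x)\<^sup>2)"
  \<comment> \<open>\<open>8 K\<close> pays for the drift and \<open>24 K\<^sup>2\<close> for each second-order term; the last \<open>1\<close> makes the
    supersolution strict.\<close>
  define L where "L = 8 * K + 24 * K\<^sup>2 * card J + 1"
  define E where "E = (\<lambda>t. exp (L * (T - t)))"
  define \<psi> where "\<psi> = (\<lambda>t x. E t * (N x)\<^sup>2)"
  have N1: "1 \<le> N x" for x by (simp add: N_def)
  have E1: "1 \<le> E t" if "t \<in> {0..T}" for t
    using that \<open>0 \<le> K\<close> by (simp add: E_def L_def)
  have Epos: "0 < E t" for t by (simp add: E_def)
  have \<psi>pos: "0 < \<psi> t x" for t x
    using Epos[of t] N1[of x] by (simp add: \<psi>_def)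
  have N_sq: "(1 + norm x) * norm x \<le> 2 * N x" "(1 + norm x)\<^sup>2 \<le> 2 * N x" for x :: 'a
    unfolding N_def by (rule square_one_plus_le norm_ge_zero)+
  have \<psi>dt: "((\<lambda>t. \<psi> t x) has_real_derivative - L * \<psi> t x) (at t within A)" for t x A
    unfolding \<psi>_def E_def by (auto intro!: derivative_eq_intros)
  have \<psi>dx: "GDERIV (\<psi> t) x :> (4 * E t * N x) *\<^sub>R x" for t x
    unfolding gderiv_def \<psi>_def N_def power2_norm_eq_inner
    by (auto intro!: derivative_eq_intros simp: inner_commute power2_eq_square algebra_simps)
  have \<psi>dxx: "((\<lambda>x. (4 * E t * N x) *\<^sub>R x) has_derivative
      (\<lambda>h. (8 * E t * (x \<bullet> h)) *\<^sub>R x + (4 * E t * N x) *\<^sub>R h)) (at x)" for t x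
    unfolding N_def power2_norm_eq_inner
    by (auto intro!: derivative_eq_intros simp: inner_commute algebra_simps)
  have barrier: "D t1 x1 \<le> \<eta> * \<psi> t1 x1" if "0 < \<eta>" for \<eta>
  proof (rule ccontr)
    assume "\<not> D t1 x1 \<le> \<eta> * \<psi> t1 x1"
    define W where "W = (\<lambda>t x. D t x - \<eta> * \<psi> t x)"
    have W1: "0 < W t1 x1" using \<open>\<not> _\<close> by (simp add: W_def)
    \<comment> \<open>Outside the ball of radius \<open>r\<close> the barrier dominates, since \<open>\<bar>M\<bar> / \<eta> \<le> r \<le> r\<^sup>2\<close>; the term
      \<open>norm x1\<close> puts the supposed bad point inside.\<close>
    define r where "r = 1 + \<bar>M\<bar> / \<eta> + norm x1"
    have "0 \<le> \<bar>M\<bar> / \<eta>" using \<open>0 < \<eta>\<close> by simp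
    then have r: "1 \<le> r" "norm x1 < r" "\<bar>M\<bar> / \<eta> \<le> r"
      unfolding r_def using norm_ge_zero[of x1] by linarith+
    have W_far: "W t x \<le> 0" if t: "t \<in> {0..T}" and "r \<le> norm x" for t x
    proof -
      have "r \<le> r\<^sup>2" using r by (simp add: power2_eq_square)
      also have "r\<^sup>2 \<le> N x" using \<open>r \<le> norm x\<close> r(1) power_mono[of r "norm x" 2] by (simp add: N_def del: power_mono_iff)
      finally have "\<bar>M\<bar> / \<eta> \<le> N x" using r(3) by linarith
      then have "\<bar>M\<bar> \<le> \<eta> * N x" using \<open>0 < \<eta>\<close> by (simp add: field_simps)
      then have "M * N x \<le> \<eta> * N x * N x" using N1[of x] by (intro mult_right_mono) auto
      also have "\<dots> \<le> \<eta> * \<psi> t x"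
        using mult_right_mono[OF E1[OF t], of "\<eta> * N x * N x"] \<open>0 < \<eta>\<close> N1[of x]
        by (simp add: \<psi>_def power2_eq_square algebra_simps)
      finally show ?thesis using growth[OF t, of x] by (simp add: W_def N_def)
    qed
    have contW: "continuous_on ({0..T} \<times> cball 0 r) (\<lambda>(t, x). W t x)"
      unfolding W_def case_prod_beta \<psi>_def E_def N_def
      using continuous_on_subset[OF cont, of "{0..T} \<times> cball 0 r"]
      by (intro continuous_intros) (auto simp: case_prod_beta)
    have "(t1, x1) \<in> {0..T} \<times> cball 0 r" using t1 r(2) by simp
    then obtain t0 x0 where p0: "(t0, x0) \<in> {0..T} \<times> cball 0 r"
      and max0: "\<And>t x. (t, x) \<in> {0..T} \<times> cball 0 r \<Longrightarrow> W t x \<le> W t0 x0"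
      using continuous_attains_sup[OF compact_Times[OF compact_Icc compact_cball] _ contW] by fastforce
    then have t0: "t0 \<in> {0..T}" and W0: "0 < W t0 x0"
      using W1 \<open>(t1, x1) \<in> _\<close> by fastforce+
    have x0: "norm x0 < r" using W_far[OF t0, of x0] W0 by linarith
    have "t0 \<noteq> T"
      using final[of x0] W0 mult_pos_pos[OF \<open>0 < \<eta>\<close> \<psi>pos[of T x0]] by (auto simp: W_def)
    then have "t0 < T" using t0 by simp
    \<comment> \<open>The maximum may sit at the initial time, so only times after \<open>t0\<close> are compared: the right
      derivative of \<open>W\<close> in time cannot be positive.\<close>
    have time: "Dt t0 x0 \<le> - L * \<eta> * \<psi> t0 x0"
    proof (rule ccontr)
      assume "\<not> ?thesis"
      then have pos: "0 < Dt t0 x0 - \<eta> * (- L * \<psi> t0 x0)" by (simp add: algebra_simps)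
      have "((\<lambda>t. W t x0) has_real_derivative Dt t0 x0 - \<eta> * (- L * \<psi> t0 x0)) (at t0 within {0..T})"
        unfolding W_def by (intro DERIV_diff DERIV_cmult dt[OF t0] \<psi>dt)
      from has_real_derivative_pos_inc_right[OF this pos] obtain d
        where d: "d > 0" "\<And>h. h > 0 \<Longrightarrow> t0 + h \<in> {0..T} \<Longrightarrow> h < d \<Longrightarrow> W t0 x0 < W (t0 + h) x0"
        by blast
      define h where "h = min (d / 2) (T - t0)"
      have "0 < h" "h < d" "t0 + h \<in> {0..T}"
        using d(1) \<open>t0 < T\<close> t0 by (auto simp: h_def min_def)
      then show False using d(2)[of h] max0[of "t0 + h" x0] x0 by fastforce
    qed
    define G where "G = (\<lambda>x. Dx t0 x - \<eta> *\<^sub>R ((4 * E t0 * N x) *\<^sub>R x))"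
    define H where "H = (\<lambda>h. Dxx t0 x0 h
        - \<eta> *\<^sub>R ((8 * E t0 * (x0 \<bullet> h)) *\<^sub>R x0 + (4 * E t0 * N x0) *\<^sub>R h))"
    have gradW: "GDERIV (W t0) x :> G x" for x
      using has_derivative_diff[OF dx[OF t0, of x, unfolded gderiv_def]
          has_derivative_mult_right[OF \<psi>dx[of t0 x, unfolded gderiv_def], of \<eta>]]
      unfolding W_def G_def gderiv_def by (simp add: inner_diff_right mult.assoc)
    have hessW: "(G has_derivative H) (at x0)"
      unfolding G_def H_def
      by (intro has_derivative_diff has_derivative_scaleR_right dxx[OF t0] \<psi>dxx)
    have local_max: "W t0 y \<le> W t0 x0" if "y \<in> ball x0 (r - norm x0)" for y
    proof (rule max0)
      have "norm y \<le> norm x0 + dist x0 y" 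
        using norm_triangle_sub[of y x0] by (simp add: dist_norm norm_minus_commute)
      then show "(t0, y) \<in> {0..T} \<times> cball 0 r" using that t0 by simp
    qed
    note critical = second_order_condition_at_maximum[OF gradW hessW diff_gt_0_iff_gt[THEN iffD2, OF x0] local_max]
    have "Dx t0 x0 = (\<eta> * 4 * E t0 * N x0) *\<^sub>R x0"
      using critical(1) by (simp add: G_def algebra_simps)
    then have bD: "b t0 x0 \<bullet> Dx t0 x0 = \<eta> * 4 * E t0 * N x0 * (b t0 x0 \<bullet> x0)" by simp
    have "b t0 x0 \<bullet> x0 \<le> K * (2 * N x0)"
    proof -
      have "b t0 x0 \<bullet> x0 \<le> norm (b t0 x0) * norm x0" by (rule norm_cauchy_schwarz)
      also have "\<dots> \<le> K * (1 + norm x0) * norm x0" by (intro mult_right_mono b t0) simp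
      also have "\<dots> \<le> K * (2 * N x0)"
        using mult_left_mono[OF N_sq(1) \<open>0 \<le> K\<close>] by (simp add: mult.assoc)
      finally show ?thesis .
    qed
    then have "\<eta> * 4 * E t0 * N x0 * (b t0 x0 \<bullet> x0) \<le> \<eta> * 4 * E t0 * N x0 * (K * (2 * N x0))"
      using \<open>0 < \<eta>\<close> Epos[of t0] N1[of x0] by (intro mult_left_mono) auto
    then have first: "b t0 x0 \<bullet> Dx t0 x0 \<le> 8 * K * (\<eta> * \<psi> t0 x0)"
      unfolding bD by (simp add: \<psi>_def power2_eq_square algebra_simps)
    have second: "s j t0 x0 \<bullet> Dxx t0 x0 (s j t0 x0) \<le> 24 * K\<^sup>2 * (\<eta> * \<psi> t0 x0)" if j: "j \<in> J" for j
    proof -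
      define y where "y = s j t0 x0"
      have "(norm y)\<^sup>2 \<le> (K * (1 + norm x0))\<^sup>2"
        unfolding y_def by (intro power_mono s j t0) simp
      also have "\<dots> \<le> K\<^sup>2 * (2 * N x0)"
        unfolding power_mult_distrib by (intro mult_left_mono N_sq) simp
      finally have "12 * N x0 * (norm y)\<^sup>2 \<le> 12 * N x0 * (K\<^sup>2 * (2 * N x0))"
        using N1[of x0] by (intro mult_left_mono) auto
      moreover have "8 * (x0 \<bullet> y)\<^sup>2 + 4 * N x0 * (norm y)\<^sup>2 \<le> 12 * N x0 * (norm y)\<^sup>2"
        using Cauchy_Schwarz_ineq[of x0 y] inner_ge_zero[of y]
        unfolding N_def power2_norm_eq_inner distrib_left distrib_right by linarith
      ultimately have "8 * (x0 \<bullet> y)\<^sup>2 + 4 * N x0 * (norm y)\<^sup>2 \<le> 24 * K\<^sup>2 * (N x0)\<^sup>2"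
        by (simp add: power2_eq_square algebra_simps)
      then have "\<eta> * E t0 * (8 * (x0 \<bullet> y)\<^sup>2 + 4 * N x0 * (norm y)\<^sup>2)
          \<le> \<eta> * E t0 * (24 * K\<^sup>2 * (N x0)\<^sup>2)"
        using \<open>0 < \<eta>\<close> Epos[of t0] by (intro mult_left_mono) auto
      moreover have "y \<bullet> H y \<le> 0" using critical(2) by simp
      then have "y \<bullet> Dxx t0 x0 y \<le> \<eta> * E t0 * (8 * (x0 \<bullet> y)\<^sup>2 + 4 * N x0 * (norm y)\<^sup>2)"
        unfolding H_def power2_norm_eq_inner
        by (simp add: inner_diff_right inner_add_right power2_eq_square algebra_simps inner_commute)
      ultimately show ?thesis
        by (simp add: y_def \<psi>_def algebra_simps)
    qed
    have "(\<Sum>j\<in>J. s j t0 x0 \<bullet> Dxx t0 x0 (s j t0 x0)) \<le> card J * (24 * K\<^sup>2 * (\<eta> * \<psi> t0 x0))"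
      by (rule sum_bounded_above) (rule second)
    then have "0 \<le> - (\<eta> * \<psi> t0 x0)"
      using subsol[OF t0, of x0] first time by (simp add: L_def algebra_simps)
    then show False using \<psi>pos[of t0 x0] \<open>0 < \<eta>\<close> by (simp add: mult_le_0_iff)
  qed
  have "((\<lambda>\<eta>. \<eta> * \<psi> t1 x1) \<longlongrightarrow> 0 * \<psi> t1 x1) (at_right 0)"
    by (intro tendsto_intros)
  then show ?thesis
    using barrier by (intro tendsto_lowerbound[of "\<lambda>\<eta>. \<eta> * \<psi> t1 x1" 0 "at_right 0"])
      (auto simp: eventually_at_right_less eventually_at_filter intro!: always_eventually)
qed

section \<open>Matrix-valued functions\<close>

lemma bounded_bilinear_matrix_mult:
  "bounded_bilinear (\<lambda>(M::real^'n^'m) (N::real^'p^'n). M ** N)"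
  unfolding bilinear_conv_bounded_bilinear[symmetric] bilinear_def linear_iff
  by (simp add: vec_eq_iff matrix_matrix_mult_def sum.distrib sum_distrib_left algebra_simps)

lemma bounded_bilinear_matrix_vector_mult:
  "bounded_bilinear (\<lambda>(M::real^'n^'m) (x::real^'n). M *v x)"
  unfolding bilinear_conv_bounded_bilinear[symmetric] bilinear_def linear_iff
  by (simp add: matrix_vector_right_distrib matrix_vector_mult_add_rdistrib
      matrix_vector_mult_scaleR scaleR_matrix_vector_assoc)

lemma bounded_linear_transpose: "bounded_linear (transpose :: real^'n^'m \<Rightarrow> real^'m^'n)"
  by (intro linear_conv_bounded_linear[THEN iffD1] linearI)
    (simp_all add: transpose_def vec_eq_iff)

lemma bounded_linear_trace: "bounded_linear (trace :: real^'n^'n \<Rightarrow> real)"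
  by (intro linear_conv_bounded_linear[THEN iffD1] linearI)
    (simp_all add: trace_def sum.distrib sum_distrib_left)

lemmas continuous_on_matrix_mult = bounded_bilinear.continuous_on[OF bounded_bilinear_matrix_mult]
lemmas continuous_on_matrix_vector_mult =
  bounded_bilinear.continuous_on[OF bounded_bilinear_matrix_vector_mult]
lemmas continuous_on_transpose = bounded_linear.continuous_on[OF bounded_linear_transpose]
lemmas continuous_on_trace = bounded_linear.continuous_on[OF bounded_linear_trace]

lemma inner_matrix_vector_mult: "x \<bullet> (M *v y) = (transpose M *v x) \<bullet> (y :: real^'n)"
  by (metis dot_lmul_matrix transpose_transpose vector_transpose_matrix)

lemma inner_mult_transpose:
  fixes N :: "real^'n^'m"
  shows "p \<bullet> ((N ** transpose N) *v p) = (norm (transpose N *v p))\<^sup>2"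
  by (metis inner_matrix_vector_mult matrix_vector_mul_assoc power2_norm_eq_inner)

text \<open>This turns the diffusion term of the equation into a sum of second derivatives along the
  columns of the diffusion coefficient.\<close>

lemma trace_mult_eq_sum_columns:
  fixes S :: "real^'n^'m"
  shows "trace (S ** transpose S ** X) = (\<Sum>j\<in>UNIV. column j S \<bullet> (X *v column j S))"
proof -
  have "trace (S ** transpose S ** X) = trace (transpose S ** (X ** S))"
    by (metis matrix_mul_assoc trace_mul_sym)
  also have "\<dots> = (\<Sum>j\<in>UNIV. column j S \<bullet> (X *v column j S))"
    by (simp add: trace_def matrix_matrix_mult_def matrix_vector_mult_def transpose_def column_def
        inner_vec_def)
  finally show ?thesis .
qed

lemma continuous_matrix_field_bound:
  fixes M :: "real \<Rightarrow> real^'n^'m"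
  assumes "continuous_on {0..T} M"
  obtains K where "0 \<le> K" and "\<And>t x. t \<in> {0..T} \<Longrightarrow> norm (M t *v x) \<le> K * norm x"
proof -
  obtain c where c: "0 \<le> c" "\<And>(M::real^'n^'m) x. norm (M *v x) \<le> norm M * norm x * c"
    using bounded_bilinear.nonneg_bounded[OF bounded_bilinear_matrix_vector_mult] by blast
  obtain a where "\<forall>t\<in>{0..T}. norm (M t) \<le> a"
    using compact_imp_bounded[OF compact_continuous_image[OF assms compact_Icc]]
    by (auto simp: bounded_iff)
  then have a: "\<And>t. t \<in> {0..T} \<Longrightarrow> norm (M t) \<le> a" by blast
  show ?thesis
  proof
    show "0 \<le> \<bar>a\<bar> * c" using c by simp
    fix t and x :: "real^'n" assume t: "t \<in> {0..T}"
    have "norm (M t *v x) \<le> norm (M t) * norm x * c" by (rule c)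
    also have "\<dots> \<le> \<bar>a\<bar> * norm x * c"
      using a[OF t] c(1) by (intro mult_right_mono) auto
    finally show "norm (M t *v x) \<le> \<bar>a\<bar> * c * norm x" by (simp add: ac_simps)
  qed
qed

section \<open>Empirical measures along continuous trajectories\<close>

lemma integral_empirical_measure:
  fixes \<phi> :: "'a::topological_space \<Rightarrow> real"
  assumes "continuous_on UNIV \<phi>"
  shows "(\<integral>x. \<phi> x \<partial>empirical_measure n \<xi>) = (\<Sum>j<n. \<phi> (\<xi> j)) / n"
  unfolding empirical_measure_def
  using borel_measurable_continuous_onI[OF assms]
  by (subst integral_distr)
    (auto simp: integral_uniform_count_measure measurable_def
      space_uniform_count_measure sets_uniform_count_measure)

text \<open>Continuous states make the empirical measure weakly continuous in time, because integrating
  against it is averaging over the \<open>n\<close> states. Hence a coefficient that is continuous in time and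
  measure stays continuous once the trajectory is inserted.\<close>

lemma continuous_on_empirical_along_trajectory:
  fixes F :: "real \<Rightarrow> (real^'k) measure \<Rightarrow> 'b::topological_space"
  assumes F: "continuous_on_empirical n T F"
    and \<xi>: "\<And>j. j < n \<Longrightarrow> continuous_on {0..T} (\<xi> j)"
    and m: "\<And>t. t \<in> {0..T} \<Longrightarrow> m t = empirical_measure n (\<lambda>j. \<xi> j t)"
  shows "continuous_on {0..T} (\<lambda>t. F t (m t))"
  unfolding continuous_on_sequentially
proof (intro allI ballI impI)
  fix s t assume t: "t \<in> {0..T}" and "(\<forall>i. s i \<in> {0..T}) \<and> s \<longlonglongrightarrow> t"
  then have s: "\<And>i. s i \<in> {0..T}" "s \<longlonglongrightarrow> t" by auto
  have "weakly_converges (\<lambda>i. m (s i)) (m t)"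
    unfolding weakly_converges_def
  proof (intro allI impI)
    fix \<phi> :: "real^'k \<Rightarrow> real" assume "continuous_on UNIV \<phi> \<and> bounded (range \<phi>)"
    then have \<phi>: "continuous_on UNIV \<phi>" by simp
    have "(\<lambda>i. \<phi> (\<xi> j (s i))) \<longlonglongrightarrow> \<phi> (\<xi> j t)" if "j < n" for j
      using \<xi>[OF that] s t
      by (intro continuous_on_tendsto_compose[OF \<phi>] continuous_on_tendsto_compose[OF \<xi>[OF that]]) auto
    then have "(\<lambda>i. (\<Sum>j<n. \<phi> (\<xi> j (s i))) / n) \<longlonglongrightarrow> (\<Sum>j<n. \<phi> (\<xi> j t)) / n"
      unfolding divide_inverse by (intro tendsto_intros) auto
    then show "(\<lambda>i. \<integral>x. \<phi> x \<partial>m (s i)) \<longlonglongrightarrow> (\<integral>x. \<phi> x \<partial>m t)"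
      using m[OF t] m[OF s(1)] by (simp add: integral_empirical_measure[OF \<phi>])
  qed
  moreover have "m r \<in> range (empirical_measure n)" if "r \<in> {0..T}" for r
    unfolding m[OF that] by (rule rangeI)
  ultimately show "((\<lambda>t. F t (m t)) \<circ> s) \<longlonglongrightarrow> F t (m t)"
    using F[unfolded continuous_on_empirical_def, rule_format, of s "\<lambda>i. m (s i)" t "m t"] s t
    unfolding o_def by simp
qed

section \<open>The infimum over the controls\<close>

text \<open>Completing the square: as a function of \<open>u\<close> the Hamiltonian is
  \<open>norm (u + B' p / 2)\<^sup>2\<close> plus a constant, so the infimum is attained at \<open>u = - B' p / 2\<close>. The lost
  term \<open>norm (B' p)\<^sup>2 / 4\<close> and the risk-sensitive term \<open>\<epsilon> / (2 \<delta>) norm (\<sigma>' p)\<^sup>2\<close> merge into one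
  quadratic form, and \<open>\<rho>\<close> is chosen so that \<open>\<epsilon> / (2 \<delta>) = 1 / (4 \<rho>\<^sup>2)\<close>: the matrix of this form
  is the one in the Riccati equation.\<close>

lemma INF_rs_hamiltonian:
  fixes B :: "real^'p^'k" and p :: "real^'k" and \<sigma> :: "real \<Rightarrow> real^'k^'k"
  assumes "0 < \<epsilon>" and "0 < \<delta>" and \<rho>: "\<rho> = sqrt (\<delta> / (2 * \<epsilon>))"
    and f: "\<And>u. f t x u = a + B *v u" and c: "\<And>u. c t x u \<mu> = q + (norm u)\<^sup>2"
  defines "G \<equiv> B ** transpose B - (1 / \<rho>\<^sup>2) *\<^sub>R (\<sigma> t ** transpose (\<sigma> t))"
  shows "bdd_below (range (rs_hamiltonian \<epsilon> \<delta> f \<sigma> c t x \<mu> p X))"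
    and "(INF u. rs_hamiltonian \<epsilon> \<delta> f \<sigma> c t x \<mu> p X u)
      = a \<bullet> p - 1 / 4 * (p \<bullet> (G *v p)) + \<epsilon> / 2 * trace (\<sigma> t ** transpose (\<sigma> t) ** X) + q"
      (is "_ = ?h")
proof -
  have \<rho>2: "1 / \<rho>\<^sup>2 = 2 * \<epsilon> / \<delta>" using assms(1,2) by (simp add: \<rho>)
  have G: "p \<bullet> (G *v p) = (norm (transpose B *v p))\<^sup>2 - 2 * \<epsilon> / \<delta> * (norm (transpose (\<sigma> t) *v p))\<^sup>2"
    unfolding G_def \<rho>2
    by (simp add: matrix_vector_mult_diff_rdistrib inner_diff_right inner_mult_transpose
        flip: scaleR_matrix_vector_assoc)
  have H: "rs_hamiltonian \<epsilon> \<delta> f \<sigma> c t x \<mu> p X u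
      = ?h + (norm (u + (1 / 2) *\<^sub>R (transpose B *v p)))\<^sup>2" for u
  proof -
    have "(B *v u) \<bullet> p = u \<bullet> (transpose B *v p)"
      by (metis inner_commute inner_matrix_vector_mult)
    then have "(B *v u) \<bullet> p + (norm u)\<^sup>2 = (norm (u + (1 / 2) *\<^sub>R (transpose B *v p)))\<^sup>2
        - 1 / 4 * (norm (transpose B *v p))\<^sup>2"
      by (simp add: power2_norm_eq_inner inner_add_left inner_add_right inner_commute)
    then show ?thesis
      unfolding rs_hamiltonian_def f c G by (simp add: inner_add_left algebra_simps)
  qed
  have ge: "?h \<le> rs_hamiltonian \<epsilon> \<delta> f \<sigma> c t x \<mu> p X u" for u
    unfolding H by simp
  show "bdd_below (range (rs_hamiltonian \<epsilon> \<delta> f \<sigma> c t x \<mu> p X))"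
    using ge by (intro bdd_belowI2[where m = ?h])
  have "rs_hamiltonian \<epsilon> \<delta> f \<sigma> c t x \<mu> p X (- (1 / 2) *\<^sub>R (transpose B *v p)) = ?h"
    unfolding H by simp
  then show "(INF u. rs_hamiltonian \<epsilon> \<delta> f \<sigma> c t x \<mu> p X u) = ?h"
    using ge by (intro cInf_eq_minimum) (auto simp only: intro: range_eqI sym)
qed

section \<open>Existence and uniqueness for the risk-sensitive equation\<close>

text \<open>The minimised Hamiltonian is quadratic in the gradient with a symmetric matrix \<open>G\<close>, and
  \<open>p\<^sub>1 \<bullet> G p\<^sub>1 - p\<^sub>2 \<bullet> G p\<^sub>2 = (p\<^sub>1 - p\<^sub>2) \<bullet> G (p\<^sub>1 + p\<^sub>2)\<close>. So the difference of two solutions solves a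
  linear equation without source, whose drift contains the gradients themselves. The growth class
  is what makes this drift grow at most linearly, as the maximum principle requires. The running
  cost \<open>q\<close> of the state cancels.\<close>

lemma rs_hjb_comparison:
  fixes A \<sigma> :: "real \<Rightarrow> real^'k^'k" and B :: "real^'p^'k"
  assumes "0 < \<epsilon>" and "0 < \<delta>"
    and A: "continuous_on {0..T} A" and \<sigma>: "continuous_on {0..T} \<sigma>"
    and f: "\<And>t x u. f t x u = A t *v x + B *v u"
    and c: "\<And>t x u \<mu>. c t x u \<mu> = q t x \<mu> + (norm u)\<^sup>2"
    and w1: "rs_hjb_solution T \<epsilon> \<delta> f \<sigma> c g m w1" "linear_gradient_growth T w1"
    and w2: "rs_hjb_solution T \<epsilon> \<delta> f \<sigma> c g m w2" "linear_gradient_growth T w2"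
    and t: "t \<in> {0..T}"
  shows "w1 t x \<le> w2 t x"
proof -
  define \<rho> where "\<rho> = sqrt (\<delta> / (2 * \<epsilon>))"
  define G where "G = (\<lambda>t. B ** transpose B - (1 / \<rho>\<^sup>2) *\<^sub>R (\<sigma> t ** transpose (\<sigma> t)))"
  define \<Phi> where "\<Phi> = (\<lambda>t x p X. (A t *v x) \<bullet> p - 1 / 4 * (p \<bullet> (G t *v p))
      + \<epsilon> / 2 * trace (\<sigma> t ** transpose (\<sigma> t) ** X) + q t x (m t))"
  have INF_H: "(INF u. rs_hamiltonian \<epsilon> \<delta> f \<sigma> c t x (m t) p X u) = \<Phi> t x p X" for t x p X
    unfolding \<Phi>_def G_def by (rule INF_rs_hamiltonian(2)[OF assms(1,2) \<rho>_def f c])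
  have sol: "\<exists>vt vx vxx. \<forall>t\<in>{0..T}. \<forall>x.
      ((\<lambda>s. w s x) has_real_derivative vt t x) (at t within {0..T}) \<and> GDERIV (w t) x :> vx t x \<and>
      (vx t has_derivative (\<lambda>h. vxx t x *v h)) (at x) \<and> vt t x + \<Phi> t x (vx t x) (vxx t x) = 0"
    if "rs_hjb_solution T \<epsilon> \<delta> f \<sigma> c g m w" for w
    using that unfolding rs_hjb_solution_def INF_H by fast
  obtain vt1 p1 X1 where s1: "\<forall>t\<in>{0..T}. \<forall>x.
      ((\<lambda>s. w1 s x) has_real_derivative vt1 t x) (at t within {0..T}) \<and> GDERIV (w1 t) x :> p1 t x \<and>
      (p1 t has_derivative (\<lambda>h. X1 t x *v h)) (at x) \<and> vt1 t x + \<Phi> t x (p1 t x) (X1 t x) = 0"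
    using sol[OF w1(1)] by blast
  obtain vt2 p2 X2 where s2: "\<forall>t\<in>{0..T}. \<forall>x.
      ((\<lambda>s. w2 s x) has_real_derivative vt2 t x) (at t within {0..T}) \<and> GDERIV (w2 t) x :> p2 t x \<and>
      (p2 t has_derivative (\<lambda>h. X2 t x *v h)) (at x) \<and> vt2 t x + \<Phi> t x (p2 t x) (X2 t x) = 0"
    using sol[OF w2(1)] by blast
  obtain C1 where C1: "norm (p1 t x) \<le> C1 * (1 + norm x)" if "t \<in> {0..T}" for t x
    using w1(2) s1 unfolding linear_gradient_growth_def by blast
  obtain C2 where C2: "norm (p2 t x) \<le> C2 * (1 + norm x)" if "t \<in> {0..T}" for t x
    using w2(2) s2 unfolding linear_gradient_growth_def by blast
  have G_cont: "continuous_on {0..T} G"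
    unfolding G_def
    by (intro continuous_intros continuous_on_matrix_mult continuous_on_transpose \<sigma>)
  have G_sym: "p \<bullet> (G t *v r) = r \<bullet> (G t *v p)" for t p r
  proof -
    have "transpose (G t) = G t"
      unfolding G_def
      by (simp add: linear_diff[OF bounded_linear.linear[OF bounded_linear_transpose]]
          transpose_scalar matrix_transpose_mul)
    then show ?thesis by (metis inner_commute inner_matrix_vector_mult)
  qed
  obtain KA where KA: "0 \<le> KA" "\<And>t x. t \<in> {0..T} \<Longrightarrow> norm (A t *v x) \<le> KA * norm x"
    using continuous_matrix_field_bound[OF A] by metis
  obtain KG where KG: "0 \<le> KG" "\<And>t x. t \<in> {0..T} \<Longrightarrow> norm (G t *v x) \<le> KG * norm x"
    using continuous_matrix_field_bound[OF G_cont] by metis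
  obtain KS where KS: "0 \<le> KS" "\<And>t x. t \<in> {0..T} \<Longrightarrow> norm (\<sigma> t *v x) \<le> KS * norm x"
    using continuous_matrix_field_bound[OF \<sigma>] by metis
  define K where "K = KA + KG * (\<bar>C1\<bar> + \<bar>C2\<bar>) + sqrt (\<epsilon> / 2) * KS"
  define D where "D = (\<lambda>t x. w1 t x - w2 t x)"
  define Dx where "Dx = (\<lambda>t x. p1 t x - p2 t x)"
  define b where "b = (\<lambda>t x. A t *v x - (1 / 4) *\<^sub>R (G t *v (p1 t x + p2 t x)))"
  define s where "s = (\<lambda>j t (x::real^'k). sqrt (\<epsilon> / 2) *\<^sub>R column j (\<sigma> t))"
  have dt: "((\<lambda>s. D s x) has_real_derivative vt1 t x - vt2 t x) (at t within {0..T})"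
    if "t \<in> {0..T}" for t x
    unfolding D_def using s1 s2 that by (intro DERIV_diff) auto
  have dx: "GDERIV (D t) x :> Dx t x" if "t \<in> {0..T}" for t x
    unfolding D_def Dx_def using s1 s2 that by (intro GDERIV_diff) auto
  have dxx: "(Dx t has_derivative (\<lambda>h. (X1 t x - X2 t x) *v h)) (at x)" if "t \<in> {0..T}" for t x
    unfolding Dx_def matrix_vector_mult_diff_rdistrib
    using s1 s2 that by (intro has_derivative_diff) auto
  have Dx_growth: "norm (Dx t x) \<le> (C1 + C2) * (1 + norm x)" if "t \<in> {0..T}" for t x
    using norm_triangle_ineq4[of "p1 t x" "p2 t x"] C1[OF that, of x] C2[OF that, of x]
    by (simp add: Dx_def distrib_right)
  have D_cont: "continuous_on {0..T} (\<lambda>t. D t x)" for x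
    by (rule DERIV_continuous_on) (rule dt)
  note regular = gradient_growth_imp_quadratic_growth[OF dx Dx_growth D_cont]
  obtain M where M: "\<And>t x. t \<in> {0..T} \<Longrightarrow> D t x \<le> M * (1 + (norm x)\<^sup>2)"
    using regular(2) by blast
  have linear: "vt1 t x - vt2 t x + b t x \<bullet> Dx t x
      + (\<Sum>j\<in>UNIV. s j t x \<bullet> ((X1 t x - X2 t x) *v s j t x)) = 0" if "t \<in> {0..T}" for t x
  proof -
    have "(\<Sum>j\<in>UNIV. s j t x \<bullet> ((X1 t x - X2 t x) *v s j t x))
        = \<epsilon> / 2 * trace (\<sigma> t ** transpose (\<sigma> t) ** (X1 t x - X2 t x))"
      using \<open>0 < \<epsilon>\<close> unfolding s_def trace_mult_eq_sum_columns
      by (simp add: matrix_vector_mult_scaleR sum_distrib_left flip: mult.assoc)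
    also have "\<dots> = \<epsilon> / 2 * trace (\<sigma> t ** transpose (\<sigma> t) ** X1 t x)
        - \<epsilon> / 2 * trace (\<sigma> t ** transpose (\<sigma> t) ** X2 t x)"
      by (simp add: bounded_bilinear.diff_right[OF bounded_bilinear_matrix_mult] right_diff_distrib
          linear_diff[OF bounded_linear.linear[OF bounded_linear_trace]])
    moreover have "b t x \<bullet> Dx t x = (A t *v x) \<bullet> p1 t x - (A t *v x) \<bullet> p2 t x
        - 1 / 4 * (p1 t x \<bullet> (G t *v p1 t x)) + 1 / 4 * (p2 t x \<bullet> (G t *v p2 t x))"
      using G_sym[of "p1 t x" t "p2 t x"]
      by (simp add: b_def Dx_def matrix_vector_right_distrib inner_diff_left inner_diff_right
          inner_add_left inner_commute[of "G t *v _"] add_divide_distrib)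
    moreover have "vt1 t x + \<Phi> t x (p1 t x) (X1 t x) = 0" "vt2 t x + \<Phi> t x (p2 t x) (X2 t x) = 0"
      using s1 s2 that by auto
    ultimately show ?thesis unfolding \<Phi>_def by linarith
  qed
  have "0 \<le> K" using KA(1) KG(1) KS(1) \<open>0 < \<epsilon>\<close> by (simp add: K_def)
  have b_growth: "norm (b t x) \<le> K * (1 + norm x)" if t: "t \<in> {0..T}" for t x
  proof -
    have "norm (p1 t x + p2 t x) \<le> (\<bar>C1\<bar> + \<bar>C2\<bar>) * (1 + norm x)"
      using norm_triangle_ineq[of "p1 t x" "p2 t x"] C1[OF t, of x] C2[OF t, of x]
        mult_right_mono[OF abs_ge_self[of C1], of "1 + norm x"]
        mult_right_mono[OF abs_ge_self[of C2], of "1 + norm x"]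
      by (simp add: distrib_right)
    then have "KG * norm (p1 t x + p2 t x) \<le> KG * ((\<bar>C1\<bar> + \<bar>C2\<bar>) * (1 + norm x))"
      using KG(1) by (rule mult_left_mono)
    then have "norm (G t *v (p1 t x + p2 t x)) \<le> KG * (\<bar>C1\<bar> + \<bar>C2\<bar>) * (1 + norm x)"
      using KG(2)[OF t, of "p1 t x + p2 t x"] by (simp add: mult.assoc)
    moreover have "norm (A t *v x) \<le> KA * (1 + norm x)"
      using KA(2)[OF t, of x] KA(1) by (simp add: distrib_left)
    moreover have "norm (b t x) \<le> norm (A t *v x) + norm (G t *v (p1 t x + p2 t x))"
      unfolding b_def
      using norm_triangle_ineq4[of "A t *v x" "(1 / 4) *\<^sub>R (G t *v (p1 t x + p2 t x))"]
        norm_ge_zero[of "G t *v (p1 t x + p2 t x)"] unfolding norm_scaleR by linarith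
    moreover have "0 \<le> sqrt (\<epsilon> / 2) * KS * (1 + norm x)"
      using KS(1) \<open>0 < \<epsilon>\<close> by simp
    ultimately show ?thesis by (simp only: K_def distrib_right)
  qed
  have s_growth: "norm (s j t x) \<le> K * (1 + norm x)" if t: "t \<in> {0..T}" for j t x
  proof -
    have "norm (column j (\<sigma> t)) \<le> KS"
      using KS(2)[OF t, of "axis j 1"] by (simp add: matrix_vector_mult_basis)
    then have "norm (s j t x) \<le> sqrt (\<epsilon> / 2) * KS"
      using \<open>0 < \<epsilon>\<close> by (simp add: s_def mult_left_mono)
    also have "\<dots> \<le> K" using KA(1) KG(1) by (simp add: K_def)
    also have "K \<le> K * (1 + norm x)" using \<open>0 \<le> K\<close> by (simp add: distrib_left)
    finally show ?thesis .
  qed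
  have "D t x \<le> 0"
  proof (rule parabolic_maximum_principle[where J = UNIV and s = s and b = b,
        OF regular(1) M dt dx dxx _ \<open>0 \<le> K\<close> b_growth s_growth _ t])
    show "D T y \<le> 0" for y
      using w1(1) w2(1) by (simp add: rs_hjb_solution_def D_def)
  qed (use linear in auto)
  then show ?thesis by (simp add: D_def)
qed

text \<open>The gradient of \<open>v\<close> is \<open>2 Z x\<close> and its Hessian \<open>2 Z\<close>, both by symmetry of \<open>Z\<close>. After insertion
  the quadratic part of the Hamilton-Jacobi-Bellman equation is the Riccati equation evaluated at
  \<open>x\<close>, and the part constant in \<open>x\<close> is balanced by the time derivative of the integral.\<close>

lemma riccati_imp_rs_hjb_solution:
  fixes A \<sigma> R Z :: "real \<Rightarrow> real^'k^'k" and B :: "real^'p^'k"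
  assumes "0 < \<epsilon>" and "0 < \<delta>" and \<rho>: "\<rho> = sqrt (\<delta> / (2 * \<epsilon>))"
    and A: "continuous_on {0..T} A" and \<sigma>: "continuous_on {0..T} \<sigma>"
    and R: "continuous_on {0..T} R"
    and f: "\<And>t x u. f t x u = A t *v x + B *v u"
    and c: "\<And>t x u. t \<in> {0..T} \<Longrightarrow> c t x u (m t) = x \<bullet> (R t *v x) + (norm u)\<^sup>2"
    and g: "\<And>x. g x = x \<bullet> (Q\<^sub>T *v x)"
    and riccati: "riccati_solution T \<rho> A B \<sigma> R Q\<^sub>T Z"
    and Z_sym: "\<And>t. t \<in> {0..T} \<Longrightarrow> transpose (Z t) = Z t"
    and v: "\<And>t x. v t x = x \<bullet> (Z t *v x)
                + \<epsilon> * integral {t..T} (\<lambda>s. trace (Z s ** \<sigma> s ** transpose (\<sigma> s)))"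
  shows "rs_hjb_solution T \<epsilon> \<delta> f \<sigma> c g m v" and "linear_gradient_growth T v"
proof -
  define G where "G = (\<lambda>t. B ** transpose B - (1 / \<rho>\<^sup>2) *\<^sub>R (\<sigma> t ** transpose (\<sigma> t)))"
  \<comment> \<open>Solving the Riccati equation for the derivative of \<open>Z\<close> shows that it is continuous on
    \<open>{0..T}\<close>, which a classical solution requires.\<close>
  define Zdot where "Zdot = (\<lambda>t. Z t ** G t ** Z t - transpose (A t) ** Z t - Z t ** A t - R t)"
  define \<tau> where "\<tau> = (\<lambda>t. trace (Z t ** \<sigma> t ** transpose (\<sigma> t)))"
  obtain Z' where Z': "\<forall>t\<in>{0..T}. (Z has_vector_derivative Z' t) (at t within {0..T}) \<and>
      Z' t + transpose (A t) ** Z t + Z t ** A t + R t - Z t ** G t ** Z t = 0" and ZT: "Z T = Q\<^sub>T"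
    using riccati unfolding riccati_solution_def G_def by blast
  have Z'_eq: "Z' t = Zdot t" if "t \<in> {0..T}" for t
    using bspec[OF Z' that] unfolding Zdot_def by (simp add: algebra_simps)
  have dZ: "(Z has_vector_derivative Zdot t) (at t within {0..T})" if "t \<in> {0..T}" for t
    using Z' that Z'_eq by auto
  have Z_cont: "continuous_on {0..T} Z"
    using dZ has_vector_derivative_continuous unfolding continuous_on_eq_continuous_within by blast
  have Zdot_cont: "continuous_on {0..T} Zdot"
    unfolding Zdot_def G_def
    by (intro continuous_intros continuous_on_matrix_mult continuous_on_transpose \<sigma> A R Z_cont)
  have \<tau>_cont: "continuous_on {0..T} \<tau>"
    unfolding \<tau>_def
    by (intro continuous_on_trace continuous_on_matrix_mult continuous_on_transpose \<sigma> Z_cont)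
  define vt where "vt = (\<lambda>t x. x \<bullet> (Zdot t *v x) - \<epsilon> * \<tau> t)"
  define vx where "vx = (\<lambda>t x. 2 *\<^sub>R (Z t *v x))"
  define vxx where "vxx = (\<lambda>t (x::real^'k). 2 *\<^sub>R Z t)"
  have fst_cont: "continuous_on ({0..T} \<times> UNIV) (\<lambda>z. h (fst z))" if "continuous_on {0..T} h"
    for h :: "real \<Rightarrow> 'b::topological_space"
    by (rule continuous_on_compose2[OF that continuous_on_fst[OF continuous_on_id]]) auto
  have dv_t: "((\<lambda>s. v s x) has_real_derivative vt t x) (at t within {0..T})" if t: "t \<in> {0..T}" for t x
  proof -
    have "bounded_linear (\<lambda>M. x \<bullet> (M *v x))"
      by (intro bounded_linear_inner_right_comp
          bounded_bilinear.bounded_linear_left[OF bounded_bilinear_matrix_vector_mult])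
    from bounded_linear.has_vector_derivative[OF this dZ[OF t]]
    have "((\<lambda>s. x \<bullet> (Z s *v x)) has_real_derivative x \<bullet> (Zdot t *v x)) (at t within {0..T})"
      by (simp add: has_real_derivative_iff_has_vector_derivative)
    from DERIV_add[OF this DERIV_cmult[OF integral_has_real_derivative'[OF \<tau>_cont t]], of \<epsilon>]
    show ?thesis by (simp add: v vt_def \<tau>_def)
  qed
  have dv_x: "GDERIV (v t) x :> vx t x" if t: "t \<in> {0..T}" for t x
  proof -
    have "((\<lambda>x. Z t *v x) has_derivative (\<lambda>h. Z t *v h)) (at x)"
      by (rule bounded_linear_imp_has_derivative[OF matrix_vector_mul_bounded_linear])
    from has_derivative_add[OF has_derivative_inner[OF has_derivative_ident this] has_derivative_const]
    have "(v t has_derivative (\<lambda>h. x \<bullet> (Z t *v h) + h \<bullet> (Z t *v x) + 0)) (at x)"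
      unfolding v[abs_def] by simp
    moreover have "x \<bullet> (Z t *v h) = h \<bullet> (Z t *v x)" for h
      by (metis Z_sym[OF t] inner_commute inner_matrix_vector_mult)
    ultimately show ?thesis by (simp add: gderiv_def vx_def)
  qed
  have dv_xx: "(vx t has_derivative (\<lambda>h. vxx t x *v h)) (at x)" for t x
    unfolding vx_def vxx_def scaleR_matrix_vector_assoc
    by (rule bounded_linear_imp_has_derivative[OF matrix_vector_mul_bounded_linear])
  have hjb: "bdd_below (range (rs_hamiltonian \<epsilon> \<delta> f \<sigma> c t x (m t) (vx t x) (vxx t x))) \<and>
      vt t x + (INF u. rs_hamiltonian \<epsilon> \<delta> f \<sigma> c t x (m t) (vx t x) (vxx t x) u) = 0"
    if t: "t \<in> {0..T}" for t x
  proof -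
    note H = INF_rs_hamiltonian[where f = f and c = c and t = t and x = x and \<sigma> = \<sigma> and B = B
        and a = "A t *v x", OF assms(1,2) \<rho> f c[OF t]]
    let ?y = "Z t *v x"
    have "x \<bullet> (Zdot t *v x) = ?y \<bullet> (G t *v ?y) - 2 * ((A t *v x) \<bullet> ?y) - x \<bullet> (R t *v x)"
    proof -
      have Z_adj: "x \<bullet> (Z t *v y) = ?y \<bullet> y" for y
        by (metis Z_sym[OF t] inner_matrix_vector_mult)
      have A_adj: "x \<bullet> (transpose (A t) *v ?y) = (A t *v x) \<bullet> ?y"
        by (metis inner_matrix_vector_mult transpose_transpose)
      show ?thesis
        unfolding Zdot_def matrix_vector_mult_diff_rdistrib inner_diff_right
          matrix_vector_mul_assoc[symmetric] Z_adj A_adj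
        by (simp add: inner_commute)
    qed
    moreover have "trace (\<sigma> t ** transpose (\<sigma> t) ** vxx t x) = 2 * \<tau> t"
    proof -
      have "\<sigma> t ** transpose (\<sigma> t) ** vxx t x = 2 *\<^sub>R (\<sigma> t ** transpose (\<sigma> t) ** Z t)"
        unfolding vxx_def by (rule bounded_bilinear.scaleR_right[OF bounded_bilinear_matrix_mult])
      moreover have "trace (\<sigma> t ** transpose (\<sigma> t) ** Z t) = \<tau> t"
        unfolding \<tau>_def by (metis trace_mul_sym matrix_mul_assoc)
      ultimately show ?thesis
        by (simp add: linear_cmul[OF bounded_linear.linear[OF bounded_linear_trace]])
    qed
    moreover have "vx t x \<bullet> (G t *v vx t x) = 4 * (?y \<bullet> (G t *v ?y))"
      by (simp add: vx_def matrix_vector_mult_scaleR)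
    ultimately show ?thesis
      using H(1) unfolding H(2) vt_def by (simp add: vx_def G_def)
  qed
  have "v T x = g x" for x by (simp add: v g ZT)
  moreover have "continuous_on ({0..T} \<times> UNIV) (\<lambda>(t, x). vt t x)"
    unfolding vt_def case_prod_unfold
    by (intro continuous_intros continuous_on_matrix_vector_mult fst_cont Zdot_cont \<tau>_cont)
  moreover have "continuous_on ({0..T} \<times> UNIV) (\<lambda>(t, x). vx t x)"
    unfolding vx_def case_prod_unfold
    by (intro continuous_intros continuous_on_matrix_vector_mult fst_cont Z_cont)
  moreover have "continuous_on ({0..T} \<times> UNIV) (\<lambda>(t, x). vxx t x)"
    unfolding vxx_def case_prod_unfold by (intro continuous_intros fst_cont Z_cont)
  ultimately show "rs_hjb_solution T \<epsilon> \<delta> f \<sigma> c g m v"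
    unfolding rs_hjb_solution_def using dv_t dv_x dv_xx hjb
    by (intro conjI exI[of _ vt] exI[of _ vx] exI[of _ vxx]) simp_all
  obtain K where K: "0 \<le> K" "\<And>t x. t \<in> {0..T} \<Longrightarrow> norm (Z t *v x) \<le> K * norm x"
    using continuous_matrix_field_bound[OF Z_cont] by metis
  show "linear_gradient_growth T v"
    unfolding linear_gradient_growth_def
  proof (intro exI ballI allI impI)
    fix t x p assume t: "t \<in> {0..T}" and "GDERIV (v t) x :> p"
    then have "(\<lambda>h. h \<bullet> p) = (\<lambda>h. h \<bullet> vx t x)"
      using dv_x[OF t] unfolding gderiv_def by (blast intro: has_derivative_unique)
    then have "p = vx t x" by (metis vector_eq_ldot)
    then show "norm p \<le> (2 * K) * (1 + norm x)"
      using K(2)[OF t, of x] K(1) by (simp add: vx_def distrib_left)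
  qed
qed

theorem proposition4:
  fixes T \<epsilon> \<delta> \<rho> :: real
    and n :: nat
    and A \<sigma> Q Z :: "real \<Rightarrow> real^'k^'k"
    and B :: "real^'p^'k"
    and Q\<^sub>T :: "real^'k^'k"
    and \<Lambda> :: "real \<Rightarrow> (real^'k) measure \<Rightarrow> real^'k^'k"
    and \<xi> :: "nat \<Rightarrow> real \<Rightarrow> real^'k"
    and m :: "real \<Rightarrow> (real^'k) measure"
    and f :: "real \<Rightarrow> real^'k \<Rightarrow> real^'p \<Rightarrow> real^'k"
    and c :: "real \<Rightarrow> real^'k \<Rightarrow> real^'p \<Rightarrow> (real^'k) measure \<Rightarrow> real"
    and g :: "real^'k \<Rightarrow> real"
    and v :: "real \<Rightarrow> real^'k \<Rightarrow> real"
  assumes "T > 0" and "\<epsilon> > 0" and "\<delta> > 0"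
    and "\<rho> = sqrt (\<delta> / (2 * \<epsilon>))"
    and "n \<ge> 1"
    and "\<And>j. j < n \<Longrightarrow> continuous_on {0..T} (\<xi> j)"
    and "\<And>t. t \<in> {0..T} \<Longrightarrow> m t = empirical_measure n (\<lambda>j. \<xi> j t)"
    and "continuous_on {0..T} A"
    and "continuous_on {0..T} \<sigma>"
    and "continuous_on {0..T} Q"
    and "\<And>t. t \<in> {0..T} \<Longrightarrow> nonneg_definite (Q t)"
    and "nonneg_definite Q\<^sub>T"
    and "\<And>t \<mu>. t \<in> {0..T} \<Longrightarrow> \<mu> \<in> range (empirical_measure n) \<Longrightarrow> transpose (\<Lambda> t \<mu>) = \<Lambda> t \<mu>"
    and "continuous_on_empirical n T \<Lambda>"
    and "f = (\<lambda>t x u. A t *v x + B *v u)"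
    and "c = (\<lambda>t x u \<mu>. x \<bullet> ((Q t - \<Lambda> t \<mu>) *v x) + (norm u)\<^sup>2)"
    and "g = (\<lambda>x. x \<bullet> (Q\<^sub>T *v x))"
    and "riccati_solution T \<rho> A B \<sigma> (\<lambda>t. Q t - \<Lambda> t (m t)) Q\<^sub>T Z"
    and "\<And>t. t \<in> {0..T} \<Longrightarrow> nonneg_definite (Z t)"
    and "v = (\<lambda>t x. x \<bullet> (Z t *v x)
                + \<epsilon> * integral {t..T} (\<lambda>s. trace (Z s ** \<sigma> s ** transpose (\<sigma> s))))"
  shows "rs_hjb_solution T \<epsilon> \<delta> f \<sigma> c g m v \<and> linear_gradient_growth T v \<and>
         (\<forall>w. rs_hjb_solution T \<epsilon> \<delta> f \<sigma> c g m w \<and> linear_gradient_growth T w \<longrightarrow>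
            (\<forall>t\<in>{0..T}. \<forall>x. w t x = v t x))"
proof -
  have f: "f t x u = A t *v x + B *v u" for t x u using assms by simp
  have c: "c t x u \<mu> = x \<bullet> ((Q t - \<Lambda> t \<mu>) *v x) + (norm u)\<^sup>2" for t x u \<mu> using assms by simp
  have g: "g x = x \<bullet> (Q\<^sub>T *v x)" for x using assms by simp
  have v_eq: "v t x = x \<bullet> (Z t *v x)
      + \<epsilon> * integral {t..T} (\<lambda>s. trace (Z s ** \<sigma> s ** transpose (\<sigma> s)))" for t x using assms by simp
  have Z_sym: "transpose (Z t) = Z t" if "t \<in> {0..T}" for t
    using assms(19)[OF that] by (simp add: nonneg_definite_def)
  have "continuous_on {0..T} (\<lambda>t. Q t - \<Lambda> t (m t))"
    using assms continuous_on_empirical_along_trajectory[of n T \<Lambda> \<xi> m]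
    by (intro continuous_on_diff) blast+
  note v = riccati_imp_rs_hjb_solution[where \<sigma> = \<sigma> and f = f and c = c and g = g and m = m and v = v,
      OF \<open>\<epsilon> > 0\<close> \<open>\<delta> > 0\<close> \<open>\<rho> = _\<close> \<open>continuous_on {0..T} A\<close> \<open>continuous_on {0..T} \<sigma>\<close> this f c g
        \<open>riccati_solution _ _ _ _ _ _ _ _\<close> Z_sym v_eq]
  have "w t x = v t x"
    if w: "rs_hjb_solution T \<epsilon> \<delta> f \<sigma> c g m w" "linear_gradient_growth T w" and t: "t \<in> {0..T}" for w t x
  proof (rule antisym)
    note comparison = rs_hjb_comparison[OF \<open>\<epsilon> > 0\<close> \<open>\<delta> > 0\<close> \<open>continuous_on {0..T} A\<close>
        \<open>continuous_on {0..T} \<sigma>\<close> f c]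
    show "w t x \<le> v t x" by (rule comparison[OF w v t])
    show "v t x \<le> w t x" by (rule comparison[OF v w t])
  qed
  with v show ?thesis by blast
qed

end
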